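(* Let $n$ be a positive integer and $k \in \{1,\dots,n-1\}$. Then $$\sum_{\sigma \in \mathfrak{S}_n} q^{\mathrm{des}_k(\sigma)} = \sum_{\sigma \in \mathfrak{S}_n} q^{\mathrm{exc}_k(\sigma)} \quad\text{and}\quad \sum_{\sigma \in \mathfrak{S}_n} q^{\mathrm{inv}_k(\sigma)} = \sum_{\sigma \in \mathfrak{S}_n} q^{\mathrm{maj}_k(\sigma)}.$$
   Context: $\mathfrak{S}_n$ is the set of permutations $\sigma = a_1a_2\cdots a_n$ of $[n]=\{1,\dots,n\}$ in one-line notation. For $1\le k\le n-1$: - $\mathrm{Des}_k(\sigma) = \{i \in [n-k] : a_i > a_{i+k}\}$ and $\mathrm{des}_k(\sigma)=|\mathrm{Des}_k(\sigma)|$; - $\mathrm{inv}_k(\sigma) = |\{(i,j) \in [n]^2 : a_i > a_j \text{ and } j-i = mk \text{ for some positive integer } m\}|$; - $\mathrm{maj}_k(\sigma) = \sum_{i \in \mathrm{Des}_k(\sigma)} \lceil i/k\rceil$; - for $1\le i\le k$, $\beta_{n,k}^i(\sigma) = a_i a_{i+k} a_{i+2k}\cdots$ is the subsequence of all entries of $\sigma$ in positions congruent to $i$ modulo $k$, and $\mathrm{exc}_k(\sigma) = \sum_{i=1}^k \mathrm{exc}(\mathrm{std}\,\beta_{n,k}^i(\sigma))$. Here $\mathrm{std}$ is standardization: replace the smallest entry of a sequence of distinct integers by $1$, the second smallest by $2$, etc. For a permutation $\tau=b_1\cdots b_m$ of $[m]$, $\mathrm{exc}(\tau) = |\{i\in[m]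 : b_i > i\}|$. *)

theory Defs
  imports
    Complex_Main
    "HOL-Combinatorics.Permutations"
    "HOL-Computational_Algebra.Polynomial"
begin

text \<open>
  A permutation of \<open>[n]\<close> is a function \<open>\<sigma> :: nat \<Rightarrow> nat\<close> with \<open>\<sigma> permutes {1..n}\<close>;
  the entry \<open>a\<^sub>i\<close> of its one-line notation is \<open>\<sigma> i\<close>. Since \<open>\<sigma>\<close> does not determine \<open>n\<close>,
  the statistics take \<open>n\<close> as an argument.
\<close>

definition Des_k :: "nat \<Rightarrow> nat \<Rightarrow> (nat \<Rightarrow> nat) \<Rightarrow> nat set" where
  "Des_k n k \<sigma> = {i \<in> {1..n - k}. \<sigma> i > \<sigma> (i + k)}"

definition des_k :: "nat \<Rightarrow> nat \<Rightarrow> (nat \<Rightarrow> nat) \<Rightarrow> nat" where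
  "des_k n k \<sigma> = card (Des_k n k \<sigma>)"

definition inv_k :: "nat \<Rightarrow> nat \<Rightarrow> (nat \<Rightarrow> nat) \<Rightarrow> nat" where
  "inv_k n k \<sigma> =
     card {(i, j) \<in> {1..n} \<times> {1..n}. \<sigma> i > \<sigma> j \<and> (\<exists>m>0. int j - int i = int m * int k)}"

definition maj_k :: "nat \<Rightarrow> nat \<Rightarrow> (nat \<Rightarrow> nat) \<Rightarrow> nat" where
  "maj_k n k \<sigma> = (\<Sum>i\<in>Des_k n k \<sigma>. nat \<lceil>real i / real k\<rceil>)"

definition beta :: "nat \<Rightarrow> nat \<Rightarrow> nat \<Rightarrow> (nat \<Rightarrow> nat) \<Rightarrow> nat list" where
  "beta n k i \<sigma> = map \<sigma> (filter (\<lambda>p. p mod k = i mod k) [1..<Suc n])"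

text \<open>Each entry is replaced by its rank among all entries; meant for lists of distinct entries.\<close>

definition std :: "nat list \<Rightarrow> nat list" where
  "std xs = map (\<lambda>x. card {y \<in> set xs. y \<le> x}) xs"

text \<open>The argument of \<open>exc\<close> is a word \<open>b\<^sub>1\<dots>b\<^sub>m\<close>; list indices start at 0, so \<open>b\<^sub>i\<close> is \<open>bs ! (i - 1)\<close>.\<close>

definition exc :: "nat list \<Rightarrow> nat" where
  "exc bs = card {i \<in> {1..length bs}. bs ! (i - 1) > i}"

definition exc_k :: "nat \<Rightarrow> nat \<Rightarrow> (nat \<Rightarrow> nat) \<Rightarrow> nat" where
  "exc_k n k \<sigma> = (\<Sum>i = 1..k. exc (std (beta n k i \<sigma>)))"

end

(*
  Split sigma into its k words on the residue classes of positions. Each of the four statistics is a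
  sum over these words, so it suffices to exchange the statistics one word at a time, which
  follows from the classical equidistributions of (des, exc) and (inv, maj) on the arrangements
  of a finite set. These come from adjoining a new maximum M to a word of length m in all m + 1
  ways: inv and maj increase by 0, ..., m, each exactly once, while des keeps its value d for
  d + 1 choices and becomes d + 1 for the other m - d, and so does exc if M displaces an entry
  to the end of the word.
*)
theory Submission
  imports Defs "HOL-Combinatorics.Multiset_Permutations"
begin

section \<open>Statistics of words and two ways of adjoining a letter\<close>

definition descents :: "nat list \<Rightarrow> nat set" where
  "descents xs = {i. Suc i < length xs \<and> xs ! i > xs ! Suc i}"

text \<open>List indices start at 0, so the descent at index \<open>i\<close> sits at position
  \<open>i + 1\<close>.\<close>

definition maj :: "nat list \<Rightarrow> nat" where
  "maj xs = (\<Sum>i\<in>descents xs. Suc i)"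

definition inversions :: "nat list \<Rightarrow> (nat \<times> nat) set" where
  "inversions xs = {(i, j). i < j \<and> j < length xs \<and> xs ! i > xs ! j}"

text \<open>The rank of a letter is its value after standardization, and index \<open>i\<close> is
  position \<open>i + 1\<close>; thus no standardized word has to be formed.\<close>

definition excedances :: "nat list \<Rightarrow> nat set" where
  "excedances xs = {i. i < length xs \<and> Suc i < card {y \<in> set xs. y \<le> xs ! i}}"

definition insert_at :: "nat \<Rightarrow> 'a \<Rightarrow> 'a list \<Rightarrow> 'a list" where
  "insert_at p x xs = take p xs @ x # drop p xs"

text \<open>If \<open>xs\<close> is a permutation of \<open>[m]\<close> in one-line notation and \<open>x = m + 1\<close>, this is composition
  with the transposition of \<open>p + 1\<close> and \<open>m + 1\<close>.\<close>

definition displace :: "nat \<Rightarrow> 'a \<Rightarrow> 'a list \<Rightarrow> 'a list" where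
  "displace p x xs = (if p < length xs then xs[p := x] @ [xs ! p] else xs @ [x])"

section \<open>Recursions for a word with one more letter at the end\<close>

lemma finite_descents [simp]: "finite (descents xs)"
  by (rule finite_subset[of _ "{..<length xs}"]) (auto simp: descents_def)

lemma finite_inversions [simp]: "finite (inversions xs)"
  by (rule finite_subset[of _ "{..<length xs} \<times> {..<length xs}"]) (auto simp: inversions_def)

lemma descents_snoc:
  "descents (xs @ [x]) =
     descents xs \<union> (if xs \<noteq> [] \<and> last xs > x then {length xs - 1} else {})"
proof (cases xs rule: rev_cases)
  case (snoc ys y)
  then show ?thesis
    by (auto simp: descents_def nth_append less_Suc_eq)
qed (auto simp: descents_def)

text \<open>Makes the union in \<open>descents_snoc\<close> disjoint, so that cardinalities and sums
  over it split.\<close>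

lemma last_index_notin_descents [simp]: "length xs - Suc 0 \<notin> descents xs"
  by (auto simp: descents_def)

lemma card_descents_snoc:
  "card (descents (xs @ [x])) = card (descents xs) + (if xs \<noteq> [] \<and> last xs > x then 1 else 0)"
  by (auto simp: descents_snoc)

lemma maj_snoc:
  "maj (xs @ [x]) = maj xs + (if xs \<noteq> [] \<and> last xs > x then length xs else 0)"
  by (auto simp: maj_def descents_snoc)

lemma card_inversions_snoc:
  "card (inversions (xs @ [x])) = card (inversions xs) + length (filter (\<lambda>y. y > x) xs)"
proof -
  let ?I = "{i. i < length xs \<and> xs ! i > x}"
  have "inversions (xs @ [x]) = inversions xs \<union> ?I \<times> {length xs}"
    by (auto simp: inversions_def nth_append less_Suc_eq)
  moreover have "inversions xs \<inter> ?I \<times> {length xs} = {}"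
    by (auto simp: inversions_def)
  ultimately show ?thesis
    by (simp add: card_Un_disjoint card_cartesian_product length_filter_conv_card)
qed

section \<open>Inserting a new maximum\<close>

lemma insert_at_snoc:
  "p \<le> length xs \<Longrightarrow> insert_at p M (xs @ [x]) = insert_at p M xs @ [x]"
  by (simp add: insert_at_def)

lemma insert_at_length: "insert_at (length xs) M xs = xs @ [M]"
  by (simp add: insert_at_def)

lemma length_insert_at [simp]: "length (insert_at p M xs) = Suc (length xs)"
  by (simp add: insert_at_def)

lemma insert_at_neq_Nil [simp]: "insert_at p M xs \<noteq> []"
  by (simp add: insert_at_def)

lemma last_insert_at: "p < length xs \<Longrightarrow> last (insert_at p M xs) = last xs"
  by (simp add: insert_at_def)

lemma length_filter_insert_at:
  "length (filter P (insert_at p M xs)) = length (filter P xs) + (if P M then 1 else 0)"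
proof -
  have "filter P xs = filter P (take p xs) @ filter P (drop p xs)"
    by (metis append_take_drop_id filter_append)
  then show ?thesis by (simp add: insert_at_def)
qed

text \<open>\<open>M\<close> forms an inversion with each of the \<open>length xs - p\<close>
  letters behind it and with none before it. An arbitrary \<open>\<phi>\<close> expresses equality
  of multisets of values and absorbs the contribution of the last letter in the induction. The slot
  at the end is left out, so that \<open>M\<close> never becomes the last letter.\<close>

lemma sum_insert_at_inversions:
  fixes \<phi> :: "nat \<Rightarrow> 'b::comm_monoid_add"
  assumes "\<And>x. x \<in> set xs \<Longrightarrow> x < M"
  shows "(\<Sum>p<length xs. \<phi> (card (inversions (insert_at p M xs)))) =
         (\<Sum>j<length xs. \<phi> (card (inversions xs) + Suc j))"
  using assms
proof (induction xs arbitrary: \<phi> rule: rev_induct)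
  case (snoc x xs)
  let ?c = "length (filter (\<lambda>y. y > x) xs)"
  \<comment> \<open>Here \<open>x\<close> stays behind both \<open>xs\<close> and \<open>M\<close>:
    it forms \<open>?c\<close> inversions with letters of \<open>xs\<close> and one with
    \<open>M\<close>.\<close>
  have "(\<Sum>p<length xs. \<phi> (card (inversions (insert_at p M (xs @ [x]))))) =
        (\<Sum>p<length xs. \<phi> (card (inversions (insert_at p M xs)) + ?c + 1))"
    using snoc.prems
    by (intro sum.cong) (auto simp: insert_at_snoc card_inversions_snoc length_filter_insert_at)
  also have "\<dots> = (\<Sum>j<length xs. \<phi> (card (inversions xs) + Suc j + ?c + 1))"
    using snoc by (intro snoc.IH[of "\<lambda>m. \<phi> (m + ?c + 1)"]) auto
  finally have *: "(\<Sum>p<length xs. \<phi> (card (inversions (insert_at p M (xs @ [x]))))) = \<dots>" .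
  \<comment> \<open>The slot directly before \<open>x\<close> is the end slot for \<open>xs\<close>
    and so is not covered by the induction hypothesis.\<close>
  have **: "insert_at (length xs) M (xs @ [x]) = (xs @ [M]) @ [x]"
    by (simp add: insert_at_snoc insert_at_length)
  have ***: "card (inversions (xs @ [M])) = card (inversions xs)"
    using snoc.prems by (auto simp: card_inversions_snoc filter_empty_conv dest: less_asym)
  have M: "x < M" using snoc.prems by simp
  \<comment> \<open>That slot has increment 1, which is the term \<open>j = 0\<close> split off
    here.\<close>
  have "(\<Sum>j<Suc (length xs). \<phi> (card (inversions xs) + ?c + Suc j)) =
        (\<Sum>j<length xs. \<phi> (card (inversions xs) + Suc j + ?c + 1)) +
        \<phi> (card (inversions xs) + ?c + 1)"
    by (simp add: sum.lessThan_Suc_shift add_ac del: sum.lessThan_Suc)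
  moreover have "(\<Sum>p<Suc (length xs). \<phi> (card (inversions (insert_at p M (xs @ [x]))))) =
        (\<Sum>j<length xs. \<phi> (card (inversions xs) + Suc j + ?c + 1)) +
        \<phi> (card (inversions xs) + ?c + 1)"
    unfolding sum.lessThan_Suc * ** card_inversions_snoc[of "xs @ [M]"] *** using M by simp
  ultimately show ?case by (simp add: card_inversions_snoc del: sum.lessThan_Suc)
qed simp

text \<open>The increments are again 1, ..., \<open>length xs\<close>, once each, though not in the
  order of the slots. In the induction on the last letter, the slot directly before it supplies
  whichever extreme value the other slots leave out.\<close>

lemma sum_insert_at_maj:
  fixes \<phi> :: "nat \<Rightarrow> 'b::comm_monoid_add"
  assumes "\<And>x. x \<in> set xs \<Longrightarrow> x < M"
  shows "(\<Sum>p<length xs. \<phi> (maj (insert_at p M xs))) = (\<Sum>j<length xs. \<phi> (maj xs + Suc j))"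
  using assms
proof (induction xs arbitrary: \<phi> rule: rev_induct)
  case (snoc x xs)
  \<comment> \<open>\<open>Suc (length xs)\<close>, not \<open>length xs\<close> as in
    \<open>maj_snoc\<close>: the inserted \<open>M\<close> moves the last letter of
    \<open>xs\<close> one position to the right.\<close>
  let ?c = "if xs \<noteq> [] \<and> last xs > x then Suc (length xs) else 0"
  have "(\<Sum>p<length xs. \<phi> (maj (insert_at p M (xs @ [x])))) =
        (\<Sum>p<length xs. \<phi> (maj (insert_at p M xs) + ?c))"
    by (intro sum.cong) (auto simp: insert_at_snoc maj_snoc last_insert_at)
  also have "\<dots> = (\<Sum>j<length xs. \<phi> (maj xs + Suc j + ?c))"
    using snoc by (intro snoc.IH[of "\<lambda>m. \<phi> (m + ?c)"]) auto
  finally have *: "(\<Sum>p<length xs. \<phi> (maj (insert_at p M (xs @ [x])))) = \<dots>" .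
  have **: "insert_at (length xs) M (xs @ [x]) = (xs @ [M]) @ [x]"
    by (simp add: insert_at_snoc insert_at_length)
  have M: "x < M" using snoc.prems by simp
  have "\<not> last xs > M" if "xs \<noteq> []"
    using snoc.prems[of "last xs"] that by auto
  \<comment> \<open>Only the descent from \<open>M\<close> to \<open>x\<close> is added to those of
    \<open>xs\<close>.\<close>
  then have ***: "maj ((xs @ [M]) @ [x]) = maj xs + Suc (length xs)"
    using M unfolding maj_snoc by auto
  show ?case
  proof (cases "xs \<noteq> [] \<and> last xs > x")
    \<comment> \<open>The final descent moves one position to the right for the other slots, so
      these have increments from 2 on; the slot before \<open>x\<close> has increment 1.\<close>
    case True
    then have "(\<Sum>j<Suc (length xs). \<phi> (maj (xs @ [x]) + Suc j)) =
        (\<Sum>j<length xs. \<phi> (maj xs + Suc j + ?c)) + \<phi> (maj xs + Suc (length xs))"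
      by (simp add: maj_snoc sum.lessThan_Suc_shift add_ac del: sum.lessThan_Suc)
    moreover have "(\<Sum>p<Suc (length xs). \<phi> (maj (insert_at p M (xs @ [x])))) =
        (\<Sum>j<length xs. \<phi> (maj xs + Suc j + ?c)) + \<phi> (maj xs + Suc (length xs))"
      unfolding sum.lessThan_Suc * ** *** ..
    ultimately show ?thesis by simp
  next
    \<comment> \<open>Without a final descent, the slot before \<open>x\<close> supplies the largest
      increment.\<close>
    case False
    then show ?thesis
      unfolding length_append_singleton sum.lessThan_Suc * ** *** maj_snoc[of xs x]
        if_not_P[OF False]
      by (simp add: add_ac)
  qed
qed simp

text \<open>Splitting a descent by \<open>M\<close> keeps the number of descents; any other slot in
  front of a letter adds one. The coefficients count the slots of either kind.\<close>

lemma sum_insert_at_descents: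
  fixes \<phi> :: "nat \<Rightarrow> 'b::comm_ring_1"
  assumes "\<And>x. x \<in> set xs \<Longrightarrow> x < M"
  shows "(\<Sum>p<length xs. \<phi> (card (descents (insert_at p M xs)))) =
         of_nat (card (descents xs)) * \<phi> (card (descents xs)) +
         (of_nat (length xs) - of_nat (card (descents xs))) * \<phi> (Suc (card (descents xs)))"
  using assms
proof (induction xs arbitrary: \<phi> rule: rev_induct)
  case Nil
  then show ?case by (simp add: descents_def)
next
  case (snoc x xs)
  let ?d = "card (descents xs)"
  let ?c = "if xs \<noteq> [] \<and> last xs > x then 1 else 0"
  have "(\<Sum>p<length xs. \<phi> (card (descents (insert_at p M (xs @ [x]))))) =
        (\<Sum>p<length xs. \<phi> (card (descents (insert_at p M xs)) + ?c))"
    by (intro sum.cong) (auto simp: insert_at_snoc card_descents_snoc last_insert_at)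
  also have "\<dots> = of_nat ?d * \<phi> (?d + ?c) + (of_nat (length xs) - of_nat ?d) * \<phi> (Suc ?d + ?c)"
    using snoc by (intro snoc.IH[of "\<lambda>m. \<phi> (m + ?c)"]) auto
  finally have *: "(\<Sum>p<length xs. \<phi> (card (descents (insert_at p M (xs @ [x]))))) = \<dots>" .
  have **: "insert_at (length xs) M (xs @ [x]) = (xs @ [M]) @ [x]"
    by (simp add: insert_at_snoc insert_at_length)
  have M: "x < M" using snoc.prems by simp
  have "\<not> last xs > M" if "xs \<noteq> []"
    using snoc.prems[of "last xs"] that by auto
  \<comment> \<open>The descent from \<open>M\<close> to \<open>x\<close> replaces a descent into
    \<open>x\<close> if there was one, so the count is \<open>Suc ?d\<close> in both cases.\<close>
  then have ***: "card (descents ((xs @ [M]) @ [x])) = Suc ?d"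
    using M unfolding card_descents_snoc by auto
  \<comment> \<open>The slot before \<open>x\<close> joins the first coefficient if
    \<open>xs\<close> ends in a letter above \<open>x\<close>, and the second one otherwise.\<close>
  show ?case
    unfolding length_append_singleton sum.lessThan_Suc * ** *** card_descents_snoc[of xs x]
    by (auto simp: algebra_simps)
qed

section \<open>Excedances after displacing a letter by a new maximum\<close>

text \<open>At \<open>p < length xs\<close> the letter \<open>M\<close> has rank
  \<open>length xs + 1\<close>, beyond its position \<open>p + 1\<close>. The displaced letter has
  rank at most \<open>length xs\<close> but stands at position \<open>length xs + 1\<close>. Every
  other letter keeps its position and its rank. At the end, \<open>M\<close> has rank equal to its
  position.\<close>

lemma excedances_displace:
  assumes "\<And>x. x \<in> set xs \<Longrightarrow> x < M" and "distinct xs" and "p \<le> length xs"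
  shows "excedances (displace p M xs) =
         (if p < length xs then insert p (excedances xs) else excedances xs)"
proof -
  have M: "M \<notin> set xs" using assms(1) by blast
  have rank: "{y \<in> insert M (set xs). y \<le> z} = {y \<in> set xs. y \<le> z}" if "z \<in> set xs" for z
    using assms(1)[OF that] by auto
  have rankM: "{y \<in> insert M (set xs). y \<le> M} = insert M (set xs)"
    using assms(1) less_imp_le by auto
  have cardM: "card (insert M (set xs)) = Suc (length xs)"
    using M assms(2) by (simp add: distinct_card)
  have le: "card {y \<in> set xs. y \<le> z} \<le> length xs" for z
    by (metis (no_types, lifting) List.finite_set assms(2) card_mono distinct_card mem_Collect_eq subsetI)
  show ?thesis
  proof (cases "p < length xs")
    case True
    have set: "set (displace p M xs) = insert M (set xs)"
    proof -
      have "set (xs[p := M]) = insert M (set xs - {xs ! p})"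
        using True assms(2) by (simp add: set_update_distinct)
      then have "insert (xs ! p) (set (xs[p := M])) = insert M (set xs)"
        using True by (metis insert_Diff insert_commute nth_mem)
      then show ?thesis using True by (simp add: displace_def)
    qed
    have "i \<in> excedances (displace p M xs) \<longleftrightarrow> i \<in> insert p (excedances xs)" for i
    proof -
      consider "i = p" | "i < length xs" "i \<noteq> p" | "i = length xs" "i \<noteq> p" | "i > length xs"
        by (meson linorder_neqE_nat)
      then show ?thesis
      proof cases
        case 1
        then have "displace p M xs ! i = M" "i < length (displace p M xs)"
          using True by (simp_all add: displace_def nth_append)
        then show ?thesis using 1 True rankM cardM unfolding excedances_def mem_Collect_eq set
          by simp
      next
        case 2
        then have "displace p M xs ! i = xs ! i" "i < length (displace p M xs)"
          using True by (simp_all add: displace_def nth_append)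
        then show ?thesis using 2 rank[of "xs ! i"] unfolding excedances_def mem_Collect_eq insert_iff set
          by simp
      next
        case 3
        then have "displace p M xs ! i = xs ! p" "i < length (displace p M xs)"
          using True by (simp_all add: displace_def nth_append)
        then show ?thesis using 3 True le[of "xs ! p"] rank[of "xs ! p"]
          unfolding excedances_def mem_Collect_eq insert_iff set
          by simp
      next
        case 4
        then show ?thesis using True by (auto simp: excedances_def displace_def)
      qed
    qed
    then show ?thesis using True by auto
  next
    case False
    then have eq: "displace p M xs = xs @ [M]" by (simp add: displace_def)
    have set: "set (xs @ [M]) = insert M (set xs)" by simp
    have "i \<in> excedances (xs @ [M]) \<longleftrightarrow> i \<in> excedances xs" for i
      using rank[of "xs ! i"] rankM cardM unfolding excedances_def mem_Collect_eq set
      by (auto simp: nth_append less_Suc_eq)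
    then show ?thesis using False eq by auto
  qed
qed

text \<open>Applied to \<open>E = excedances xs\<close>, this gives the same expression as
  \<open>sum_insert_at_descents\<close>, with excedances in place of descents.\<close>

lemma sum_card_insert:
  fixes \<phi> :: "nat \<Rightarrow> 'b::comm_ring_1"
  assumes "E \<subseteq> {..<m}"
  shows "(\<Sum>p<m. \<phi> (card (insert p E))) =
         of_nat (card E) * \<phi> (card E) + (of_nat m - of_nat (card E)) * \<phi> (Suc (card E))"
proof -
  have fin: "finite E" using assms finite_subset by blast
  have "(\<Sum>p<m. \<phi> (card (insert p E))) =
        (\<Sum>p\<in>{..<m} - E. \<phi> (card (insert p E))) + (\<Sum>p\<in>E. \<phi> (card (insert p E)))"
    using assms by (intro sum.subset_diff) auto
  also have "(\<Sum>p\<in>{..<m} - E. \<phi> (card (insert p E))) = (\<Sum>p\<in>{..<m} - E. \<phi> (Suc (card E)))"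
    using fin by (intro sum.cong) auto
  also have "(\<Sum>p\<in>E. \<phi> (card (insert p E))) = (\<Sum>p\<in>E. \<phi> (card E))"
    by (intro sum.cong) (auto simp: insert_absorb)
  also have "of_nat (card ({..<m} - E)) = (of_nat m - of_nat (card E) :: 'b)"
    using assms fin card_mono[OF _ assms] by (simp add: card_Diff_subset of_nat_diff)
  ultimately show ?thesis by (simp add: add_ac)
qed

section \<open>Sums over arrangements with one more letter\<close>

text \<open>\<open>c\<close> stands for \<open>insert_at\<close> or \<open>displace\<close>.
  Surjectivity comes from counting: with \<open>m = card A\<close>, an injection on m! words with m
  + 1 slots each has (m + 1)! values.\<close>

lemma sum_permutations_of_set_insert:
  fixes h :: "'a list \<Rightarrow> 'b::comm_monoid_add"
  assumes "finite A" and "M \<notin> A"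
    and inj: "\<And>xs ys p q. \<lbrakk>xs \<in> permutations_of_set A; ys \<in> permutations_of_set A;
                p \<le> card A; q \<le> card A; c p M xs = c q M ys\<rbrakk> \<Longrightarrow> xs = ys \<and> p = q"
    and into: "\<And>xs p. xs \<in> permutations_of_set A \<Longrightarrow> p \<le> card A \<Longrightarrow>
                 c p M xs \<in> permutations_of_set (insert M A)"
  shows "(\<Sum>ys\<in>permutations_of_set (insert M A). h ys) =
         (\<Sum>xs\<in>permutations_of_set A. \<Sum>p\<le>card A. h (c p M xs))"
proof -
  let ?f = "\<lambda>(xs, p). c p M xs" and ?D = "permutations_of_set A \<times> {..card A}"
  have inj: "inj_on ?f ?D"
    using assms(3) by (force intro: inj_onI)
  have "?f ` ?D = permutations_of_set (insert M A)"
  proof (rule card_subset_eq)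
    show "card (?f ` ?D) = card (permutations_of_set (insert M A))"
      using assms(1,2) by (simp add: card_image[OF inj] card_cartesian_product)
  qed (use into assms(1) in auto)
  then have "(\<Sum>ys\<in>permutations_of_set (insert M A). h ys) = (\<Sum>z\<in>?D. h (?f z))"
    using sum.reindex[OF inj, of h] by (simp add: o_def)
  then show ?thesis by (simp add: sum.cartesian_product case_prod_beta)
qed

lemma sum_insert_at:
  fixes h :: "'a list \<Rightarrow> 'b::comm_monoid_add"
  assumes "finite A" and "M \<notin> A"
  shows "(\<Sum>ys\<in>permutations_of_set (insert M A). h ys) =
         (\<Sum>xs\<in>permutations_of_set A. \<Sum>p\<le>card A. h (insert_at p M xs))"
proof (rule sum_permutations_of_set_insert[OF assms])
  show "xs = ys \<and> p = q"
    if *: "xs \<in> permutations_of_set A" "ys \<in> permutations_of_set A"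
      "p \<le> card A" "q \<le> card A" "insert_at p M xs = insert_at q M ys" for xs ys p q
  proof -
    have M: "M \<notin> set xs" "M \<notin> set ys" and len: "length xs = card A" "length ys = card A"
      using * assms by (auto dest: permutations_of_setD length_finite_permutations_of_set)
    \<comment> \<open>\<open>M\<close> occurs in neither \<open>xs\<close> nor \<open>ys\<close>, so
      its single occurrence splits the common word in only one way.\<close>
    have "take p xs = take q ys \<and> drop p xs = drop q ys"
      using *(5) M unfolding insert_at_def
      by (subst (asm) append_Cons_eq_iff) (auto dest: in_set_takeD in_set_dropD)
    then show ?thesis
      using *(3,4) len by (metis append_take_drop_id length_take min.absorb2)
  qed
next
  fix xs p
  assume *: "xs \<in> permutations_of_set A"
  have "set (take p xs) \<union> set (drop p xs) = set xs" "set (take p xs) \<inter> set (drop p xs) = {}"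
    by (metis append_take_drop_id set_append,
        metis * append_take_drop_id distinct_append permutations_of_setD(2))
  then show "insert_at p M xs \<in> permutations_of_set (insert M A)"
    using * assms by (auto simp: insert_at_def permutations_of_set_def)
qed

text \<open>The construction can be undone: the slot is the index at which \<open>M\<close> stands,
  and the letter displaced from there is found at the end, at index \<open>card A\<close>.\<close>

lemma sum_displace:
  fixes h :: "'a list \<Rightarrow> 'b::comm_monoid_add"
  assumes "finite A" and "M \<notin> A"
  shows "(\<Sum>ys\<in>permutations_of_set (insert M A). h ys) =
         (\<Sum>xs\<in>permutations_of_set A. \<Sum>p\<le>card A. h (displace p M xs))"
proof (rule sum_permutations_of_set_insert[OF assms])
  have nth: "displace p M xs ! i = (if i = p then M else if i < length xs then xs ! i else xs ! p)"
    if "p \<le> length xs" "i \<le> length xs" for p i and xs :: "'a list"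
    using that by (auto simp: displace_def nth_append nth_list_update)
  show "xs = ys \<and> p = q"
    if *: "xs \<in> permutations_of_set A" "ys \<in> permutations_of_set A"
      "p \<le> card A" "q \<le> card A" "displace p M xs = displace q M ys" for xs ys p q
  proof -
    have M: "M \<notin> set xs" "M \<notin> set ys" and len: "length xs = card A" "length ys = card A"
      using * assms by (auto dest: permutations_of_setD length_finite_permutations_of_set)
    have pq: "p = q"
    proof (rule ccontr)
      assume "p \<noteq> q"
      have "displace p M xs ! p = M" using *(3) len by (simp add: nth)
      moreover have "displace q M ys ! p \<noteq> M"
        using *(3,4) len M \<open>p \<noteq> q\<close> by (auto simp: nth dest: nth_mem)
      ultimately show False using *(5) by simp
    qed
    have "xs ! i = ys ! i" if "i < card A" for i
    proof (cases "i = p")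
      case True
      then have "displace p M xs ! card A = xs ! i" "displace q M ys ! card A = ys ! i"
        using *(3) len pq that by (simp_all add: nth)
      then show ?thesis using *(5) by simp
    next
      case False
      then have "displace p M xs ! i = xs ! i" "displace q M ys ! i = ys ! i"
        using *(3) len pq that by (simp_all add: nth)
      then show ?thesis using *(5) by simp
    qed
    then show ?thesis using pq len by (simp add: nth_equalityI)
  qed
next
  fix xs p
  assume *: "xs \<in> permutations_of_set A"
  then show "displace p M xs \<in> permutations_of_set (insert M A)"
    using assms
    by (auto simp: displace_def permutations_of_set_def set_update_distinct distinct_list_update)
qed

section \<open>Classical equidistributions on the arrangements of a set\<close>

text \<open>MacMahon's theorem. The induction removes the largest letter, with \<open>\<phi>\<close>
  kept general because the hypothesis is applied to its sum over all increments.\<close>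

theorem inversions_maj_equidistributed:
  fixes \<phi> :: "nat \<Rightarrow> 'b::comm_monoid_add" and A :: "nat set"
  assumes "finite A"
  shows "(\<Sum>xs\<in>permutations_of_set A. \<phi> (card (inversions xs))) =
         (\<Sum>xs\<in>permutations_of_set A. \<phi> (maj xs))"
  using assms
proof (induction A arbitrary: \<phi> rule: finite_linorder_max_induct)
  case empty
  then show ?case by (simp add: inversions_def maj_def descents_def)
next
  case (insert M A)
  have M: "M \<notin> A" using insert by blast
  \<comment> \<open>The total of \<open>\<phi>\<close> over all ways of adjoining \<open>M\<close>
    to a word with value \<open>s\<close>.\<close>
  let ?\<psi> = "\<lambda>s. \<Sum>j\<le>card A. \<phi> (s + j)"
  have lt: "length xs = card A" "x \<in> set xs \<Longrightarrow> x < M" if "xs \<in> permutations_of_set A" for x xs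
    using that insert by (auto dest: permutations_of_setD length_finite_permutations_of_set)
  \<comment> \<open>Increment 0 belongs to the end slot, which the sums over
    \<open>p < length xs\<close> omit.\<close>
  have shift: "(\<Sum>j\<le>card A. g j) = (\<Sum>j<card A. g (Suc j)) + g 0" for g :: "nat \<Rightarrow> 'b"
    by (simp add: lessThan_Suc_atMost[symmetric] sum.lessThan_Suc_shift add.commute del: sum.lessThan_Suc)
  have 1: "(\<Sum>p\<le>card A. \<phi> (card (inversions (insert_at p M xs)))) = ?\<psi> (card (inversions xs))"
    if "xs \<in> permutations_of_set A" for xs
  proof -
    have "filter (\<lambda>y. y > M) xs = []" using lt[OF that] by (auto simp: filter_empty_conv dest: less_asym)
    then show ?thesis
      using sum_insert_at_inversions[of xs M \<phi>] lt[OF that]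
      unfolding shift[of "\<lambda>j. \<phi> (_ + j)"] by (auto simp: lessThan_Suc_atMost[symmetric]
          insert_at_length[of xs, unfolded lt(1)[OF that]] card_inversions_snoc)
  qed
  have 2: "(\<Sum>p\<le>card A. \<phi> (maj (insert_at p M xs))) = ?\<psi> (maj xs)"
    if "xs \<in> permutations_of_set A" for xs
  proof -
    have "\<not> (xs \<noteq> [] \<and> last xs > M)" using lt(2)[OF that, of "last xs"] by auto
    then show ?thesis
      using sum_insert_at_maj[of xs M \<phi>] lt[OF that]
      unfolding shift[of "\<lambda>j. \<phi> (_ + j)"] by (auto simp: lessThan_Suc_atMost[symmetric]
          insert_at_length[of xs, unfolded lt(1)[OF that]] maj_snoc)
  qed
  show ?case
    unfolding sum_insert_at[OF insert.hyps(1) M]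
    using insert.IH[of ?\<psi>] by (simp add: 1 2 cong: sum.cong)
qed

text \<open>Both statistics are Eulerian. Descents are followed through \<open>insert_at\<close> and
  excedances through \<open>displace\<close>; the two constructions lead to the same
  \<open>?\<psi>\<close>.\<close>

theorem descents_excedances_equidistributed:
  fixes \<phi> :: "nat \<Rightarrow> 'b::comm_ring_1" and A :: "nat set"
  assumes "finite A"
  shows "(\<Sum>xs\<in>permutations_of_set A. \<phi> (card (descents xs))) =
         (\<Sum>xs\<in>permutations_of_set A. \<phi> (card (excedances xs)))"
  using assms
proof (induction A arbitrary: \<phi> rule: finite_linorder_max_induct)
  case empty
  then show ?case by (simp add: excedances_def descents_def)
next
  case (insert M A)
  have M: "M \<notin> A" using insert by blast
  \<comment> \<open>The last summand is the end slot, which changes neither statistic.\<close>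
  let ?\<psi> = "\<lambda>s. of_nat s * \<phi> s + (of_nat (card A) - of_nat s) * \<phi> (Suc s) + \<phi> s"
  have lt: "length xs = card A" "x \<in> set xs \<Longrightarrow> x < M" "distinct xs"
    if "xs \<in> permutations_of_set A" for x xs
    using that insert by (auto dest: permutations_of_setD length_finite_permutations_of_set)
  have 1: "(\<Sum>p\<le>card A. \<phi> (card (descents (insert_at p M xs)))) = ?\<psi> (card (descents xs))"
    if "xs \<in> permutations_of_set A" for xs
  proof -
    have "\<not> (xs \<noteq> [] \<and> last xs > M)" using lt(2)[OF that, of "last xs"] by auto
    then show ?thesis
      using sum_insert_at_descents[of xs M \<phi>] lt[OF that]
      by (auto simp: lessThan_Suc_atMost[symmetric]
          insert_at_length[of xs, unfolded lt(1)[OF that]] card_descents_snoc)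
  qed
  have 2: "(\<Sum>p\<le>card A. \<phi> (card (excedances (displace p M xs)))) = ?\<psi> (card (excedances xs))"
    if "xs \<in> permutations_of_set A" for xs
  proof -
    have "(\<Sum>p<card A. \<phi> (card (excedances (displace p M xs)))) =
          (\<Sum>p<card A. \<phi> (card (insert p (excedances xs))))"
      using lt[OF that] by (intro sum.cong) (auto simp: excedances_displace)
    also have "\<dots> = of_nat (card (excedances xs)) * \<phi> (card (excedances xs)) +
        (of_nat (card A) - of_nat (card (excedances xs))) * \<phi> (Suc (card (excedances xs)))"
      using lt[OF that] by (intro sum_card_insert) (auto simp: excedances_def)
    finally show ?thesis
      using lt[OF that] by (simp add: lessThan_Suc_atMost[symmetric] excedances_displace)
  qed
  have "(\<Sum>xs\<in>permutations_of_set (insert M A). \<phi> (card (descents xs))) =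
        (\<Sum>xs\<in>permutations_of_set A. ?\<psi> (card (descents xs)))"
    unfolding sum_insert_at[OF insert.hyps(1) M] by (intro sum.cong refl 1)
  also have "\<dots> = (\<Sum>xs\<in>permutations_of_set A. ?\<psi> (card (excedances xs)))"
    by (rule insert.IH)
  also have "\<dots> = (\<Sum>xs\<in>permutations_of_set (insert M A). \<phi> (card (excedances xs)))"
    unfolding sum_displace[OF insert.hyps(1) M] by (intro sum.cong refl 2[symmetric])
  finally show ?case .
qed

section \<open>Exchanging statistics block by block\<close>

text \<open>Since \<open>\<sigma>\<close> is injective on the block, different \<open>\<tau>\<close>
  give different words; surjectivity again follows by counting, both sides having
  \<open>card (set ps)\<close> factorial terms.\<close>

lemma sum_map_permutes:
  fixes h :: "'b list \<Rightarrow> 'c::comm_monoid_add"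
  assumes "distinct ps" and inj: "inj_on \<sigma> (set ps)"
  shows "(\<Sum>\<tau> | \<tau> permutes set ps. h (map (\<sigma> \<circ> \<tau>) ps)) = (\<Sum>w\<in>permutations_of_set (\<sigma> ` set ps). h w)"
proof -
  let ?f = "\<lambda>\<tau>. map (\<sigma> \<circ> \<tau>) ps" and ?D = "{\<tau>. \<tau> permutes set ps}"
  have inj_f: "inj_on ?f ?D"
  proof (rule inj_onI)
    fix \<tau> \<tau>' assume *: "\<tau> \<in> ?D" "\<tau>' \<in> ?D" "?f \<tau> = ?f \<tau>'"
    then have "\<tau> x = \<tau>' x" if "x \<in> set ps" for x
      using that inj_onD[OF inj, of "\<tau> x" "\<tau>' x"] by (auto simp: permutes_in_image)
    moreover have "\<tau> x = \<tau>' x" if "x \<notin> set ps" for x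
      using * that by (simp add: permutes_not_in)
    ultimately show "\<tau> = \<tau>'" by blast
  qed
  have "?f ` ?D = permutations_of_set (\<sigma> ` set ps)"
  proof (rule card_subset_eq)
    show "?f ` ?D \<subseteq> permutations_of_set (\<sigma> ` set ps)"
    proof (clarify, rule permutations_of_setI)
      fix \<tau> assume \<tau>: "\<tau> permutes set ps"
      show "set (?f \<tau>) = \<sigma> ` set ps"
        using permutes_image[OF \<tau>] by (metis image_comp list.set_map)
      have "inj_on (\<sigma> \<circ> \<tau>) (set ps)"
        using inj permutes_image[OF \<tau>] permutes_inj_on[OF \<tau>] by (intro comp_inj_on) auto
      then show "distinct (?f \<tau>)"
        using assms(1) by (simp add: distinct_map)
    qed
    show "card (?f ` ?D) = card (permutations_of_set (\<sigma> ` set ps))"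
      using inj by (simp add: card_image[OF inj_f] card_permutations[OF refl] card_image)
  qed simp
  then show ?thesis
    using sum.reindex[OF inj_f, of h] by (simp add: o_def)
qed

text \<open>Averaging over right multiplication by the permutations of the block \<open>ps\<close> isolates the
  contribution of that block.\<close>

lemma equidistributed_block:
  fixes \<phi> :: "nat \<Rightarrow> 'b::{idom, ring_char_0}" and s t :: "nat list \<Rightarrow> nat"
  assumes equi: "\<And>A (\<psi> :: nat \<Rightarrow> 'b). finite A \<Longrightarrow>
      (\<Sum>w\<in>permutations_of_set A. \<psi> (s w)) = (\<Sum>w\<in>permutations_of_set A. \<psi> (t w))"
    and ps: "distinct ps" "set ps \<subseteq> S"
    and R: "\<And>\<sigma> \<tau>. \<tau> permutes set ps \<Longrightarrow> R (\<sigma> \<circ> \<tau>) = R \<sigma>"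
  shows "(\<Sum>\<sigma> | \<sigma> permutes S. \<phi> (s (map \<sigma> ps) + R \<sigma>)) =
         (\<Sum>\<sigma> | \<sigma> permutes S. \<phi> (t (map \<sigma> ps) + R \<sigma>))"
proof -
  let ?T = "{\<tau>. \<tau> permutes set ps}"
  \<comment> \<open>For fixed \<open>\<sigma>\<close>, the words of
    \<open>\<sigma> \<circ> \<tau>\<close> on \<open>ps\<close> run through all arrangements of
    their letters while \<open>R\<close> stays constant. So \<open>equi\<close> will apply to the
    inner sum, with \<open>u\<close> equal to \<open>s\<close> and to \<open>t\<close>.\<close>
  have avg: "of_nat (card ?T) * (\<Sum>\<sigma> | \<sigma> permutes S. \<phi> (u (map \<sigma> ps) + R \<sigma>)) =
      (\<Sum>\<sigma> | \<sigma> permutes S. \<Sum>w\<in>permutations_of_set (\<sigma> ` set ps). \<phi> (u w + R \<sigma>))" for u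
  proof -
    let ?F = "\<lambda>\<sigma>. \<phi> (u (map \<sigma> ps) + R \<sigma>)"
    have "of_nat (card ?T) * (\<Sum>\<sigma> | \<sigma> permutes S. ?F \<sigma>) = (\<Sum>\<tau>\<in>?T. \<Sum>\<sigma> | \<sigma> permutes S. ?F \<sigma>)"
      by simp
    \<comment> \<open>Right multiplication by a fixed \<open>\<tau>\<close> is a bijection of the
      permutations of \<open>S\<close>.\<close>
    also have "\<dots> = (\<Sum>\<tau>\<in>?T. \<Sum>\<sigma> | \<sigma> permutes S. ?F (\<sigma> \<circ> \<tau>))"
      using ps(2) by (intro sum.cong refl sum_permutations_compose_right) (auto intro: permutes_subset)
    also have "\<dots> = (\<Sum>\<sigma> | \<sigma> permutes S. \<Sum>\<tau>\<in>?T. ?F (\<sigma> \<circ> \<tau>))"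
      by (rule sum.swap)
    also have "\<dots> = (\<Sum>\<sigma> | \<sigma> permutes S. \<Sum>\<tau>\<in>?T. \<phi> (u (map (\<sigma> \<circ> \<tau>) ps) + R \<sigma>))"
      using R by (intro sum.cong) auto
    also have "\<dots> = (\<Sum>\<sigma> | \<sigma> permutes S. \<Sum>w\<in>permutations_of_set (\<sigma> ` set ps). \<phi> (u w + R \<sigma>))"
      using ps(1) permutes_inj_on by (intro sum.cong sum_map_permutes refl) auto
    finally show ?thesis .
  qed
  have "of_nat (card ?T) * (\<Sum>\<sigma> | \<sigma> permutes S. \<phi> (s (map \<sigma> ps) + R \<sigma>)) =
        of_nat (card ?T) * (\<Sum>\<sigma> | \<sigma> permutes S. \<phi> (t (map \<sigma> ps) + R \<sigma>))"
    unfolding avg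
    by (intro sum.cong refl equi[where \<psi> = "\<lambda>m. \<phi> (m + _)"]) simp
  \<comment> \<open>A nonzero natural number can be cancelled in a domain of characteristic
    0.\<close>
  moreover have "card ?T \<noteq> 0"
    by (simp add: card_permutations[OF refl])
  ultimately show ?thesis by simp
qed

text \<open>Applies \<open>equidistributed_block\<close> to one block after another. Its
  \<open>R\<close> is the contribution of all other blocks, which by disjointness ignores
  permutations of the current one.\<close>

lemma equidistributed_blocks:
  fixes \<phi> :: "nat \<Rightarrow> 'b::{idom, ring_char_0}" and s t :: "nat list \<Rightarrow> nat"
  assumes equi: "\<And>A (\<psi> :: nat \<Rightarrow> 'b). finite A \<Longrightarrow>
      (\<Sum>w\<in>permutations_of_set A. \<psi> (s w)) = (\<Sum>w\<in>permutations_of_set A. \<psi> (t w))"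
    and "finite I" and dist: "\<And>i. i \<in> I \<Longrightarrow> distinct (ps i)" and sub: "\<And>i. i \<in> I \<Longrightarrow> set (ps i) \<subseteq> S"
    and disj: "disjoint_family_on (\<lambda>i. set (ps i)) I"
  shows "(\<Sum>\<sigma> | \<sigma> permutes S. \<phi> (\<Sum>i\<in>I. s (map \<sigma> (ps i)))) =
         (\<Sum>\<sigma> | \<sigma> permutes S. \<phi> (\<Sum>i\<in>I. t (map \<sigma> (ps i))))"
proof -
  \<comment> \<open>Interpolates between the two sides: on the blocks in \<open>J\<close> the
    statistic \<open>s\<close> is already replaced by \<open>t\<close>.\<close>
  have "(\<Sum>\<sigma> | \<sigma> permutes S. \<phi> (\<Sum>i\<in>I. s (map \<sigma> (ps i)))) =
        (\<Sum>\<sigma> | \<sigma> permutes S. \<phi> ((\<Sum>i\<in>J. t (map \<sigma> (ps i))) + (\<Sum>i\<in>I - J. s (map \<sigma> (ps i)))))"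
    if "finite J" "J \<subseteq> I" for J
    using that
  proof (induction J rule: finite_induct)
    case (insert j J)
    let ?R = "\<lambda>\<sigma>. (\<Sum>i\<in>J. t (map \<sigma> (ps i))) + (\<Sum>i\<in>I - insert j J. s (map \<sigma> (ps i)))"
    have fix_other: "map (\<sigma> \<circ> \<tau>) (ps i) = map \<sigma> (ps i)"
      if "\<tau> permutes set (ps j)" "i \<in> I" "i \<noteq> j" for \<sigma> \<tau> :: "nat \<Rightarrow> nat" and i
    proof -
      have "\<tau> x = x" if "x \<in> set (ps i)" for x
        using disj insert.prems \<open>i \<in> I\<close> \<open>i \<noteq> j\<close> that
        by (intro permutes_not_in[OF \<open>\<tau> permutes set (ps j)\<close>]) (auto simp: disjoint_family_on_def)
      then show ?thesis by simp
    qed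
    have "?R (\<sigma> \<circ> \<tau>) = ?R \<sigma>" if "\<tau> permutes set (ps j)" for \<sigma> \<tau>
      using insert.prems insert.hyps
      by (intro arg_cong2[where f = "(+)"] sum.cong refl arg_cong[where f = t] arg_cong[where f = s]
          fix_other[OF that]) auto
    then have "(\<Sum>\<sigma> | \<sigma> permutes S. \<phi> (s (map \<sigma> (ps j)) + ?R \<sigma>)) =
          (\<Sum>\<sigma> | \<sigma> permutes S. \<phi> (t (map \<sigma> (ps j)) + ?R \<sigma>))"
      using insert.prems dist[of j] sub[of j] by (intro equidistributed_block[OF equi]) auto
    moreover have "(\<Sum>i\<in>I - J. s (map \<sigma> (ps i))) =
        s (map \<sigma> (ps j)) + (\<Sum>i\<in>I - insert j J. s (map \<sigma> (ps i)))" for \<sigma>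
    proof -
      have "I - J = insert j (I - insert j J)" using insert by auto
      then show ?thesis using \<open>finite I\<close> by (metis (no_types, lifting) Diff_iff finite_Diff insertI1 sum.insert)
    qed
    ultimately show ?case using insert by (simp add: add_ac)
  qed simp
  from this[of I] show ?thesis using \<open>finite I\<close> by simp
qed

section \<open>Words on the residue classes of positions\<close>

lemma exc_std: "distinct xs \<Longrightarrow> exc (std xs) = card (excedances xs)"
  unfolding exc_def
\<comment> \<open>\<open>exc\<close> counts positions from 1 and \<open>excedances\<close> indices
  from 0, hence the two shifts.\<close>
proof (rule bij_betw_same_card[OF bij_betw_byWitness[where f = "\<lambda>i. i - 1" and f' = Suc]])
qed (auto simp: std_def excedances_def image_def)

definition residue_positions :: "nat \<Rightarrow> nat \<Rightarrow> nat \<Rightarrow> nat list" where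
  "residue_positions n k i = filter (\<lambda>p. p mod k = i mod k) [1..<Suc n]"

lemma beta_conv_map: "beta n k i \<sigma> = map \<sigma> (residue_positions n k i)"
  by (simp add: beta_def residue_positions_def)

text \<open>Both lists increase strictly, so comparing their sets suffices. The explicit form gives
  access to the words by index. As \<open>i \<le> k \<le> n\<close>, the subtraction
  \<open>n - i\<close> does not truncate.\<close>

lemma residue_positions_conv_map:
  assumes "i \<in> {1..k}" and "k \<le> n"
  shows "residue_positions n k i = map (\<lambda>j. i + j * k) [0..<Suc ((n - i) div k)]"
proof (rule sorted_distinct_set_unique)
  show "sorted (residue_positions n k i)" "distinct (residue_positions n k i)"
    using sorted_wrt_filter[OF sorted_upt] by (simp_all add: residue_positions_def del: upt_Suc)
  have mono: "strict_mono (\<lambda>j. i + j * k)"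
    using assms by (auto intro!: strict_monoI)
  show "sorted (map (\<lambda>j. i + j * k) [0..<Suc ((n - i) div k)])"
    unfolding sorted_map strict_mono_less_eq[OF mono] by (rule sorted_upt)
  show "distinct (map (\<lambda>j. i + j * k) [0..<Suc ((n - i) div k)])"
    using strict_mono_imp_inj_on[OF mono] by (simp add: distinct_map inj_on_subset del: upt_Suc)
  have "(p mod k = i mod k \<and> 1 \<le> p \<and> p \<le> n) \<longleftrightarrow> (\<exists>j \<le> (n - i) div k. p = i + j * k)" for p
  proof
    assume p: "p mod k = i mod k \<and> 1 \<le> p \<and> p \<le> n"
    \<comment> \<open>A smaller \<open>p\<close> would be its own residue; for \<open>i = k\<close>
      the residue is 0, which a positive \<open>p < k\<close> does not have.\<close>
    have "i \<le> p"
    proof (rule ccontr)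
      assume "\<not> i \<le> p"
      then have "p mod k = p" using assms by simp
      then show False using p \<open>\<not> i \<le> p\<close> assms by (cases "i = k") auto
    qed
    then have "k dvd p - i" using p by (simp add: mod_eq_dvd_iff_nat)
    then obtain j where "p - i = k * j" by (elim dvdE)
    then have j: "p = i + j * k" using \<open>i \<le> p\<close> by (simp add: mult.commute)
    then have "j \<le> (n - i) div k"
      using p assms by (simp add: less_eq_div_iff_mult_less_eq)
    with j show "\<exists>j \<le> (n - i) div k. p = i + j * k" by blast
  next
    assume "\<exists>j \<le> (n - i) div k. p = i + j * k"
    then show "p mod k = i mod k \<and> 1 \<le> p \<and> p \<le> n"
      using assms by (auto simp: less_eq_div_iff_mult_less_eq)
  qed
  then show "set (residue_positions n k i) = set (map (\<lambda>j. i + j * k) [0..<Suc ((n - i) div k)])"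
    unfolding set_eq_iff
    by (simp add: residue_positions_def image_iff less_Suc_eq_le Bex_def conj_ac del: upt_Suc)
qed

lemma length_beta_iff:
  assumes "i \<in> {1..k}" and "k \<le> n"
  shows "j < length (beta n k i \<sigma>) \<longleftrightarrow> i + j * k \<le> n"
  using assms by (auto simp: beta_conv_map residue_positions_conv_map less_Suc_eq_le
      less_eq_div_iff_mult_less_eq simp del: upt_Suc)

lemma nth_beta:
  assumes "i \<in> {1..k}" and "k \<le> n" and "i + j * k \<le> n"
  shows "beta n k i \<sigma> ! j = \<sigma> (i + j * k)"
  using assms by (auto simp: beta_conv_map residue_positions_conv_map less_Suc_eq_le
      less_eq_div_iff_mult_less_eq simp del: upt_Suc)

text \<open>Classes are numbered from 1 to \<open>k\<close>, so a position is shifted down by 1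
  before division with remainder. With \<open>pred_div_mod\<close>, this makes positive positions
  correspond to pairs of a class \<open>i\<close> and an index \<open>j\<close>.\<close>

lemma div_mod_pred:
  fixes i j k :: nat
  assumes "i \<in> {1..k}"
  shows "(i + j * k - 1) div k = j" "Suc ((i + j * k - 1) mod k) = i"
proof -
  obtain i' where "i = Suc i'" "i' < k" using assms by (cases i) auto
  then show "(i + j * k - 1) div k = j" "Suc ((i + j * k - 1) mod k) = i"
    by auto
qed

lemma pred_div_mod:
  fixes p k :: nat
  assumes "p \<ge> 1" "k \<ge> 1"
  shows "Suc ((p - 1) mod k) + (p - 1) div k * k = p" "Suc ((p - 1) mod k) \<in> {1..k}"
  using assms mod_div_mult_eq[of "p - 1" k] by (auto simp: Suc_leI)

text \<open>A step of size \<open>k\<close> between positions is a step between neighbours in one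
  word. The weight \<open>g\<close> allows for both \<open>des_k\<close> and
  \<open>maj_k\<close>.\<close>

lemma sum_Des_k:
  fixes g :: "nat \<Rightarrow> nat"
  assumes "1 \<le> k" and "k \<le> n"
  shows "(\<Sum>p\<in>Des_k n k \<sigma>. g p) = (\<Sum>i=1..k. \<Sum>j\<in>descents (beta n k i \<sigma>). g (i + j * k))"
proof -
  have desc: "j \<in> descents (beta n k i \<sigma>) \<longleftrightarrow>
      i + Suc j * k \<le> n \<and> \<sigma> (i + j * k) > \<sigma> (i + Suc j * k)" if "i \<in> {1..k}" for i j
    unfolding descents_def mem_Collect_eq length_beta_iff[OF that assms(2)]
    using nth_beta[OF that assms(2), of j] nth_beta[OF that assms(2), of "Suc j"] by auto
  have "(\<Sum>i=1..k. \<Sum>j\<in>descents (beta n k i \<sigma>). g (i + j * k)) =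
        (\<Sum>(i, j)\<in>(SIGMA i:{1..k}. descents (beta n k i \<sigma>)). g (i + j * k))"
    by (simp add: sum.Sigma)
  also have "\<dots> = (\<Sum>p\<in>Des_k n k \<sigma>. g p)"
  proof (rule sum.reindex_bij_witness[where
        j = "\<lambda>(i, j). i + j * k" and i = "\<lambda>p. (Suc ((p - 1) mod k), (p - 1) div k)"])
    fix p assume "p \<in> Des_k n k \<sigma>"
    then have p: "1 \<le> p" "p + k \<le> n" "\<sigma> p > \<sigma> (p + k)" using assms by (auto simp: Des_k_def)
    let ?i = "Suc ((p - 1) mod k)" and ?j = "(p - 1) div k"
    have eq: "?i + ?j * k = p" "?i + Suc ?j * k = p + k" and i: "?i \<in> {1..k}"
      using pred_div_mod[OF p(1) assms(1)] by auto
    show "(case (?i, ?j) of (i, j) \<Rightarrow> i + j * k) = p" using eq by simp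
    show "(?i, ?j) \<in> (SIGMA i:{1..k}. descents (beta n k i \<sigma>))"
      using p i unfolding mem_Sigma_iff desc[OF i] eq by auto
  next
    fix z assume "z \<in> (SIGMA i:{1..k}. descents (beta n k i \<sigma>))"
    then obtain i j where z: "z = (i, j)" and i: "i \<in> {1..k}" and "j \<in> descents (beta n k i \<sigma>)" by auto
    then have j: "i + j * k + k \<le> n" "\<sigma> (i + j * k) > \<sigma> (i + j * k + k)" by (auto simp: desc add_ac)
    show "(case z of (i, j) \<Rightarrow> i + j * k) \<in> Des_k n k \<sigma>"
      using i j by (auto simp: Des_k_def z)
    show "(Suc (((case z of (i, j) \<Rightarrow> i + j * k) - 1) mod k), ((case z of (i, j) \<Rightarrow> i + j * k) - 1) div k) = z"
      unfolding z using div_mod_pred[OF i] by simp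
    show "g (case z of (i, j) \<Rightarrow> i + j * k) = (case z of (i, j) \<Rightarrow> g (i + j * k))"
      by (simp add: z)
  qed
  finally show ?thesis ..
qed

lemma des_k_conv_descents:
  assumes "1 \<le> k" and "k \<le> n"
  shows "des_k n k \<sigma> = (\<Sum>i=1..k. card (descents (beta n k i \<sigma>)))"
  using sum_Des_k[OF assms, of "\<lambda>_. 1"] by (simp add: des_k_def)

lemma maj_k_conv_maj:
  assumes "1 \<le> k" and "k \<le> n"
  shows "maj_k n k \<sigma> = (\<Sum>i=1..k. maj (beta n k i \<sigma>))"
proof -
  \<comment> \<open>Since 0 < i/k \<le> 1, the ceiling is the position of the descent within its
    word.\<close>
  have "nat \<lceil>real (i + j * k) / real k\<rceil> = Suc j" if "i \<in> {1..k}" for i j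
  proof -
    have "\<lceil>real (i + j * k) / real k\<rceil> = int (Suc j)"
      using that by (intro ceiling_unique) (auto simp: field_simps)
    then show ?thesis by simp
  qed
  then show ?thesis
    unfolding maj_k_def sum_Des_k[OF assms] maj_def by (intro sum.cong) auto
qed

text \<open>Two positions differ by a positive multiple of \<open>k\<close> exactly if they lie in
  the same word, in this order.\<close>

lemma inv_k_conv_inversions:
  assumes "1 \<le> k" and "k \<le> n"
  shows "inv_k n k \<sigma> = (\<Sum>i=1..k. card (inversions (beta n k i \<sigma>)))"
proof -
  let ?B = "SIGMA i:{1..k}. inversions (beta n k i \<sigma>)"
  let ?A = "{(p, q) \<in> {1..n} \<times> {1..n}. \<sigma> p > \<sigma> q \<and> (\<exists>m>0. int q - int p = int m * int k)}"
  let ?f = "\<lambda>(i, a, b). (i + a * k, i + b * k)"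
  \<comment> \<open>One class suffices for the pair, since both positions lie in it.\<close>
  let ?g = "\<lambda>(p, q). (Suc ((p - 1) mod k), (p - 1) div k, (q - 1) div k)"
  have inversion: "(a, b) \<in> inversions (beta n k i \<sigma>) \<longleftrightarrow>
      a < b \<and> i + b * k \<le> n \<and> \<sigma> (i + a * k) > \<sigma> (i + b * k)" if "i \<in> {1..k}" for i a b
  proof -
    have "i + a * k \<le> n" if "a < b" "i + b * k \<le> n"
      using that mult_le_mono1[of a b k] by linarith
    then show ?thesis
      unfolding inversions_def mem_Collect_eq case_prod_conv length_beta_iff[OF that assms(2)]
      using nth_beta[OF that assms(2), of a] nth_beta[OF that assms(2), of b] by auto
  qed
  have "bij_betw ?f ?B ?A"
  proof (rule bij_betw_byWitness[where f' = ?g])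
    show "\<forall>z\<in>?B. ?g (?f z) = z"
      using div_mod_pred by auto
    show "?f ` ?B \<subseteq> ?A"
    proof clarify
      fix i a b assume i: "i \<in> {1..k}" and "(a, b) \<in> inversions (beta n k i \<sigma>)"
      then have ab: "a < b" "i + b * k \<le> n" "\<sigma> (i + a * k) > \<sigma> (i + b * k)"
        by (auto simp: inversion)
      moreover have "int (i + b * k) - int (i + a * k) = int (b - a) * int k"
        using ab by (simp add: of_nat_diff left_diff_distrib)
      moreover have "i + a * k \<le> n"
        using ab mult_le_mono1[of a b k] by linarith
      ultimately show "(i + a * k, i + b * k) \<in> {1..n} \<times> {1..n} \<and> \<sigma> (i + b * k) < \<sigma> (i + a * k) \<and>
          (\<exists>m>0. int (i + b * k) - int (i + a * k) = int m * int k)"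
        using i by (intro conjI exI[of _ "b - a"]) auto
    qed
    have *: "?f (?g z) = z \<and> ?g z \<in> ?B" if A: "z \<in> ?A" for z
    proof -
      obtain p q m where z: "z = (p, q)" and pq: "1 \<le> p" "p \<le> n" "q \<le> n" "\<sigma> p > \<sigma> q"
        and m: "m > 0" "int q - int p = int m * int k"
        using A by auto
      have q: "q = p + m * k"
        using m(2) by (metis add.commute diff_add_cancel of_nat_add of_nat_eq_iff of_nat_mult)
      let ?i = "Suc ((p - 1) mod k)" and ?a = "(p - 1) div k"
      have p: "?i + ?a * k = p" and i: "?i \<in> {1..k}"
        using pred_div_mod[OF pq(1) assms(1)] by auto
      \<comment> \<open>Hence \<open>q\<close> is in the class of \<open>p\<close>, at index
        \<open>?a + m\<close> of the word.\<close>
      have q': "q = ?i + (?a + m) * k"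
        using p q by (simp add: add_mult_distrib)
      then have b: "(q - 1) div k = ?a + m"
        using div_mod_pred(1)[OF i] by metis
      show ?thesis
        unfolding z case_prod_conv b mem_Sigma_iff inversion[OF i] p q'[symmetric]
        using i m pq by auto
    qed
    then show "\<forall>z\<in>?A. ?f (?g z) = z" "?g ` ?A \<subseteq> ?B"
      by blast+
  qed
  then have "card ?A = card ?B"
    by (rule bij_betw_same_card[symmetric])
  then show ?thesis by (simp add: inv_k_def)
qed

theorem corollary2p5:
  fixes n k :: nat
  assumes "n \<ge> 1" and "k \<in> {1..n - 1}"
  shows "(\<Sum>\<sigma> | \<sigma> permutes {1..n}. monom (1 :: int) (des_k n k \<sigma>))
           = (\<Sum>\<sigma> | \<sigma> permutes {1..n}. monom 1 (exc_k n k \<sigma>))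
       \<and> (\<Sum>\<sigma> | \<sigma> permutes {1..n}. monom (1 :: int) (inv_k n k \<sigma>))
           = (\<Sum>\<sigma> | \<sigma> permutes {1..n}. monom 1 (maj_k n k \<sigma>))"
proof -
  let ?ps = "residue_positions n k"
  have k: "1 \<le> k" "k \<le> n" using assms by auto
  have dist: "distinct (?ps i)" and sub: "set (?ps i) \<subseteq> {1..n}" for i
    by (auto simp: residue_positions_def)
  have "disjoint_family_on (\<lambda>i. set (?ps i)) {1..k}"
    unfolding disjoint_family_on_def
  proof (intro ballI impI)
    fix i j assume ij: "i \<in> {1..k}" "j \<in> {1..k}" "i \<noteq> j"
    \<comment> \<open>In \<open>{1..k}\<close> the residue 0 is represented by \<open>k\<close>,
      every other residue by itself.\<close>
    then have "i mod k \<noteq> j mod k"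
      by (cases "i = k"; cases "j = k") auto
    then show "set (?ps i) \<inter> set (?ps j) = {}"
      by (auto simp: residue_positions_def)
  qed
  \<comment> \<open>\<open>monom 1 m\<close> is the power q^m, so this choice of
    \<open>\<phi>\<close> yields the generating functions.\<close>
  note blocks = equidistributed_blocks[OF _ finite_atLeastAtMost dist sub this,
      where \<phi> = "monom (1 :: int)", folded beta_conv_map]
  \<comment> \<open>Injectivity of \<open>\<sigma>\<close> makes its words distinct lists, to which
    \<open>exc_std\<close> applies.\<close>
  have "exc_k n k \<sigma> = (\<Sum>i=1..k. card (excedances (beta n k i \<sigma>)))" if "\<sigma> permutes {1..n}" for \<sigma>
    unfolding exc_k_def beta_conv_map
    using dist permutes_inj_on[OF that] by (intro sum.cong refl exc_std) (simp add: distinct_map)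
  then have "(\<Sum>\<sigma> | \<sigma> permutes {1..n}. monom (1 :: int) (des_k n k \<sigma>))
           = (\<Sum>\<sigma> | \<sigma> permutes {1..n}. monom 1 (exc_k n k \<sigma>))"
    using blocks[OF descents_excedances_equidistributed] by (simp add: des_k_conv_descents[OF k])
  moreover have "(\<Sum>\<sigma> | \<sigma> permutes {1..n}. monom (1 :: int) (inv_k n k \<sigma>))
           = (\<Sum>\<sigma> | \<sigma> permutes {1..n}. monom 1 (maj_k n k \<sigma>))"
    using blocks[OF inversions_maj_equidistributed]
    by (simp add: inv_k_conv_inversions[OF k] maj_k_conv_maj[OF k])
  ultimately show ?thesis ..
qed

end
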